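(* Let $V:\mathbb{R}^2\to\mathbb{R}$ and $W:\mathbb{R}^2\to\mathbb{R}$ be functions with $W(x,y)=W(-x,-y)$ for all $(x,y)$, and let $\Omega=[a,b]\times[c,d]$ be partitioned by a (possibly nonuniform) Cartesian mesh as in the context. For $n\ge1$ and a time step $\tau>0$, let $\rho^{n+1}=\{\rho^{n+1}_{i,j}\}$ be obtained from $\rho^n$ and $\rho^{n-1}$ by the two-step scheme $$\frac{\rho^*_{i,j}-\rho^n_{i,j}}{\tau/2}=\frac{C^*_{i+1/2,j}-C^*_{i-1/2,j}}{h^x_i}+\frac{C^*_{i,j+1/2}-C^*_{i,j-1/2}}{h^y_j},\qquad \rho^{n+1}_{i,j}=2\rho^*_{i,j}-\rho^n_{i,j},$$ for $1\le i\le N_x$, $1\le j\le N_y$, with the fluxes defined in the context. Then: (1) Conservation of mass: with the initialization of $\rho^0$ and $\rho^1$ described in the context, $$\sum_{i=1}^{N_x}\sum_{j=1}^{N_y}h^x_ih^y_j\rho^n_{i,j}=\int_\Omega\rho_0(x,y)\,dx\,dy\qquad\text{for } n\ge1.$$ (2) Positivity preserving: if $\rho^n_{i,j}\ge0$ for all $i\in\{1,\dots,N_x\}$ and $j\in\{1,\dots,N_y\}$, then $\rho^{n+1}_{i,j}\ge0$ for all $i,j$, provided $\tau$ is sufficiently small (i.e., for given $\rho^{n-1}$ and $\rho^n$ with $\rho^n_{i,j}\ge0$ for all $i,j$ there is $\tau_0>0$ such that the conclusion holds for every $\tau\in(0,\tau_0)$).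
   Context: Mesh: $\Omega=[a,b]\times[c,d]$ is partitioned into cells $I_{i,j}=[x_{i-1/2},x_{i+1/2}]\times[y_{j-1/2},y_{j+1/2}]$, $1\le i\le N_x$, $1\le j\le N_y$, with $x_{1/2}=a$, $x_{N_x+1/2}=b$, $y_{1/2}=c$, $y_{N_y+1/2}=d$, side lengths $h^x_i,h^y_j>0$, area $|I_{i,j}|=h^x_ih^y_j$, and centers $(x_i,y_j)=(x_{i-1/2}+\frac12h^x_i,\,y_{j-1/2}+\frac12h^y_j)$. Set $h^x_{i+1/2}=(h^x_i+h^x_{i+1})/2$ and $h^y_{j+1/2}=(h^y_j+h^y_{j+1})/2$. For $x,y\in\mathbb{R}$ and $v\in\mathbb{R}^{N_x\times N_y}$ define $$Q_2(x,y,v)=\exp\Big(-V(x,y)-\sum_{k=1}^{N_x}\sum_{l=1}^{N_y}h^x_kh^y_lW(x_k-x,y_l-y)v_{k,l}\Big).$$ In the two-step scheme, with $w=\frac32\rho^n-\frac12\rho^{n-1}$, set $M^*_{i+1/2,j}=Q_2(x_{i+1/2},y_j,w)$, $M^*_{i,j+1/2}=Q_2(x_i,y_{j+1/2},w)$, $M^*_{i,j}=Q_2(x_i,y_j,w)$, and $$C^*_{i+1/2,j}=\frac{M^*_{i+1/2,j}}{h^x_{i+1/2}}\Big(\frac{\rho^*_{i+1,j}}{M^*_{i+1,j}}-\frac{\rho^*_{i,j}}{M^*_{i,j}}\Big),\quad 1\le i\le N_x-1,\ 1\le j\le N_y,$$ $$C^*_{i,j+1/2}=\frac{M^*_{i,j+1/2}}{h^y_{j+1/2}}\Big(\frac{\rho^*_{i,j+1}}{M^*_{i,j+1}}-\frac{\rho^*_{i,j}}{M^*_{i,j}}\Big),\quad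 1\le i\le N_x,\ 1\le j\le N_y-1,$$ with $C^*_{1/2,j}=C^*_{N_x+1/2,j}=C^*_{i,1/2}=C^*_{i,N_y+1/2}=0$ for all $i,j$; the first equation of the scheme is then a linear system for $\rho^*$. Initialization: $\rho^0_{i,j}=\frac1{|I_{i,j}|}\int_{I_{i,j}}\rho_0(x,y)\,dx\,dy$ for the (integrable) initial datum $\rho_0$, and $\rho^1$ is computed from $\rho^0$ by one step of the first order scheme $$\frac{\rho^1_{i,j}-\rho^0_{i,j}}{\tau}=\frac{C^{0,*}_{i+1/2,j}-C^{0,*}_{i-1/2,j}}{h^x_i}+\frac{C^{0,*}_{i,j+1/2}-C^{0,*}_{i,j-1/2}}{h^y_j},$$ where $C^{0,*}_{i+1/2,j}$, $C^{0,*}_{i,j+1/2}$ are given by the same formulas as $C^*_{i+1/2,j}$, $C^*_{i,j+1/2}$ with $\rho^*$ replaced by $\rho^1$ and $w$ replaced by $\rho^0$ (and zero boundary fluxes). *)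

theory Defs
  imports "HOL-Analysis.Analysis"
begin

text \<open>
  Half-integer indices are shifted down: \<open>xe m i\<close> is $x_{i+1/2}$ and \<open>ye m j\<close> is $y_{j+1/2}$, so
  only \<open>xe m 0, \<dots>, xe m (Nx m)\<close> and \<open>ye m 0, \<dots>, ye m (Ny m)\<close> are meaningful.
\<close>

record mesh =
  Nx :: nat
  Ny :: nat
  xe :: "nat \<Rightarrow> real"
  ye :: "nat \<Rightarrow> real"

definition cartesian_mesh :: "real \<Rightarrow> real \<Rightarrow> real \<Rightarrow> real \<Rightarrow> mesh \<Rightarrow> bool" where
  "cartesian_mesh a b c d m \<longleftrightarrow>
     1 \<le> Nx m \<and> 1 \<le> Ny m \<and>
     xe m 0 = a \<and> xe m (Nx m) = b \<and> ye m 0 = c \<and> ye m (Ny m) = d \<and>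
     (\<forall>i\<in>{1..Nx m}. xe m (i - 1) < xe m i) \<and>
     (\<forall>j\<in>{1..Ny m}. ye m (j - 1) < ye m j)"

definition hx :: "mesh \<Rightarrow> nat \<Rightarrow> real" where
  "hx m i = xe m i - xe m (i - 1)"

definition hy :: "mesh \<Rightarrow> nat \<Rightarrow> real" where
  "hy m j = ye m j - ye m (j - 1)"

definition xc :: "mesh \<Rightarrow> nat \<Rightarrow> real" where
  "xc m i = xe m (i - 1) + hx m i / 2"

definition yc :: "mesh \<Rightarrow> nat \<Rightarrow> real" where
  "yc m j = ye m (j - 1) + hy m j / 2"

definition cell :: "mesh \<Rightarrow> nat \<Rightarrow> nat \<Rightarrow> (real \<times> real) set" where
  "cell m i j = {xe m (i - 1)..xe m i} \<times> {ye m (j - 1)..ye m j}"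

text \<open>
  A grid function in $R^{N_x \times N_y}$ is a function on pairs of natural numbers of which only
  the values at \<open>i \<in> {1..Nx m}\<close>, \<open>j \<in> {1..Ny m}\<close> are used.
\<close>

type_synonym grid = "nat \<Rightarrow> nat \<Rightarrow> real"

definition grid_nonneg :: "mesh \<Rightarrow> grid \<Rightarrow> bool" where
  "grid_nonneg m r \<longleftrightarrow> (\<forall>i\<in>{1..Nx m}. \<forall>j\<in>{1..Ny m}. 0 \<le> r i j)"

definition Q2 ::
  "mesh \<Rightarrow> (real \<Rightarrow> real \<Rightarrow> real) \<Rightarrow> (real \<Rightarrow> real \<Rightarrow> real) \<Rightarrow> real \<Rightarrow> real \<Rightarrow> grid \<Rightarrow> real"
where
  "Q2 m V W x y v =
     exp (- V x y - (\<Sum>k=1..Nx m. \<Sum>l=1..Ny m. hx m k * hy m l * W (xc m k - x) (yc m l - y) * v k l))"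

text \<open>
  \<open>flux_x m V W w r i j\<close> is $C_{i+1/2,j}$ and \<open>flux_y m V W w r i j\<close> is $C_{i,j+1/2}$, with the
  coefficients $M$ computed from \<open>w\<close> and the unknown density \<open>r\<close>.  The boundary fluxes vanish.
\<close>

definition flux_x ::
  "mesh \<Rightarrow> (real \<Rightarrow> real \<Rightarrow> real) \<Rightarrow> (real \<Rightarrow> real \<Rightarrow> real) \<Rightarrow> grid \<Rightarrow> grid \<Rightarrow> nat \<Rightarrow> nat \<Rightarrow> real"
where
  "flux_x m V W w r i j =
     (if i = 0 \<or> i = Nx m then 0
      else Q2 m V W (xe m i) (yc m j) w / ((hx m i + hx m (i + 1)) / 2) *
           (r (i + 1) j / Q2 m V W (xc m (i + 1)) (yc m j) w
            - r i j / Q2 m V W (xc m i) (yc m j) w))"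

definition flux_y ::
  "mesh \<Rightarrow> (real \<Rightarrow> real \<Rightarrow> real) \<Rightarrow> (real \<Rightarrow> real \<Rightarrow> real) \<Rightarrow> grid \<Rightarrow> grid \<Rightarrow> nat \<Rightarrow> nat \<Rightarrow> real"
where
  "flux_y m V W w r i j =
     (if j = 0 \<or> j = Ny m then 0
      else Q2 m V W (xc m i) (ye m j) w / ((hy m j + hy m (j + 1)) / 2) *
           (r i (j + 1) / Q2 m V W (xc m i) (yc m (j + 1)) w
            - r i j / Q2 m V W (xc m i) (yc m j) w))"

text \<open>
  The linear system for the new density \<open>r'\<close>, given the old density \<open>r\<close>, the increment \<open>s\<close>
  and the density \<open>w\<close> at which the coefficients are frozen.
\<close>

definition implicit_step ::
  "mesh \<Rightarrow> (real \<Rightarrow> real \<Rightarrow> real) \<Rightarrow> (real \<Rightarrow> real \<Rightarrow> real) \<Rightarrow> real \<Rightarrow> grid \<Rightarrow> grid \<Rightarrow> grid \<Rightarrow> bool"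
where
  "implicit_step m V W s w r r' \<longleftrightarrow>
     (\<forall>i\<in>{1..Nx m}. \<forall>j\<in>{1..Ny m}.
        (r' i j - r i j) / s =
          (flux_x m V W w r' i j - flux_x m V W w r' (i - 1) j) / hx m i +
          (flux_y m V W w r' i j - flux_y m V W w r' i (j - 1)) / hy m j)"

definition first_order_step ::
  "mesh \<Rightarrow> (real \<Rightarrow> real \<Rightarrow> real) \<Rightarrow> (real \<Rightarrow> real \<Rightarrow> real) \<Rightarrow> real \<Rightarrow> grid \<Rightarrow> grid \<Rightarrow> bool"
where
  "first_order_step m V W \<tau> r r' \<longleftrightarrow> implicit_step m V W \<tau> r r r'"

text \<open>The arguments \<open>r\<^sub>0 r\<^sub>1 r\<^sub>2\<close> are $\rho^{n-1}$, $\rho^n$ and $\rho^{n+1}$; \<open>rs\<close> is $\rho^*$.\<close>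

definition two_step ::
  "mesh \<Rightarrow> (real \<Rightarrow> real \<Rightarrow> real) \<Rightarrow> (real \<Rightarrow> real \<Rightarrow> real) \<Rightarrow> real \<Rightarrow> grid \<Rightarrow> grid \<Rightarrow> grid \<Rightarrow> bool"
where
  "two_step m V W \<tau> r\<^sub>0 r\<^sub>1 r\<^sub>2 \<longleftrightarrow>
     (\<exists>rs. implicit_step m V W (\<tau> / 2) (\<lambda>i j. 3 / 2 * r\<^sub>1 i j - 1 / 2 * r\<^sub>0 i j) r\<^sub>1 rs \<and>
           (\<forall>i\<in>{1..Nx m}. \<forall>j\<in>{1..Ny m}. r\<^sub>2 i j = 2 * rs i j - r\<^sub>1 i j))"

definition cell_averages :: "mesh \<Rightarrow> (real \<times> real \<Rightarrow> real) \<Rightarrow> grid \<Rightarrow> bool" where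
  "cell_averages m f r \<longleftrightarrow>
     (\<forall>i\<in>{1..Nx m}. \<forall>j\<in>{1..Ny m}.
        r i j = 1 / (hx m i * hy m j) * (LINT p:cell m i j|lebesgue. f p))"

end

theory Submission
  imports Defs
begin

text \<open>
  Mass. Multiplying an implicit step by the cell area and summing over the mesh turns the flux
  differences into telescoping sums, which vanish because there is no flux through the boundary
  (\<open>implicit_step_mass\<close>). The extrapolation $\rho^{n+1} = 2\rho^* - \rho^n$ then keeps the mass of
  $\rho^n$, since $\rho^*$ has the same mass. The mass of the cell averages is the integral of the
  datum because the cells overlap in null sets only (\<open>cell_averages_mass\<close>).

  Positivity. A flux is a nonnegative conductance times a difference of the quotients $\rho^*/M^*$
  in adjacent cells. In a cell where $\rho^*/M^*$ is minimal no mass flows out, so $\rho^*$ is at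
  least $\rho^n \ge 0$ there. As $M^*$ is positive, $\rho^* \ge 0$ everywhere (\<open>implicit_step_nonneg\<close>).
  Knowing this, one bounds the outflow from each cell by $K \rho^*$, where $K$ depends only on the
  mesh and on $M^*$, and gets $\rho^n \le (1 + K\tau/2) \rho^*$ (\<open>implicit_step_lower_bound\<close>). For
  $K\tau/2 \le 1$ this says that $2\rho^* - \rho^n \ge 0$. The bound is proportional to $\rho^n$, so it
  also covers cells in which $\rho^n$ vanishes, where convergence of $\rho^*$ to $\rho^n$ as
  $\tau \to 0$ would not be enough.
\<close>

section \<open>The mesh and its conductances\<close>

lemma cartesian_mesh_hx_pos: "cartesian_mesh a b c d m \<Longrightarrow> i \<in> {1..Nx m} \<Longrightarrow> 0 < hx m i"
  by (simp add: cartesian_mesh_def hx_def)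

lemma cartesian_mesh_hy_pos: "cartesian_mesh a b c d m \<Longrightarrow> j \<in> {1..Ny m} \<Longrightarrow> 0 < hy m j"
  by (simp add: cartesian_mesh_def hy_def)

lemma Q2_pos: "0 < Q2 m V W x y w"
  by (simp add: Q2_def)

definition equilibrium ::
  "mesh \<Rightarrow> (real \<Rightarrow> real \<Rightarrow> real) \<Rightarrow> (real \<Rightarrow> real \<Rightarrow> real) \<Rightarrow> grid \<Rightarrow> grid" where
  "equilibrium m V W w i j = Q2 m V W (xc m i) (yc m j) w"

lemma equilibrium_pos: "0 < equilibrium m V W w i j"
  by (simp add: equilibrium_def Q2_pos)

text \<open>
  The conductance of a boundary face is zero. This encodes the boundary condition, so that
  \<open>flux_x_eq\<close> and \<open>flux_y_eq\<close> hold on every face without a case distinction.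
\<close>

definition conductance_x ::
  "mesh \<Rightarrow> (real \<Rightarrow> real \<Rightarrow> real) \<Rightarrow> (real \<Rightarrow> real \<Rightarrow> real) \<Rightarrow> grid \<Rightarrow> grid" where
  "conductance_x m V W w i j =
     (if i = 0 \<or> i = Nx m then 0
      else Q2 m V W (xe m i) (yc m j) w / ((hx m i + hx m (i + 1)) / 2))"

definition conductance_y ::
  "mesh \<Rightarrow> (real \<Rightarrow> real \<Rightarrow> real) \<Rightarrow> (real \<Rightarrow> real \<Rightarrow> real) \<Rightarrow> grid \<Rightarrow> grid" where
  "conductance_y m V W w i j =
     (if j = 0 \<or> j = Ny m then 0
      else Q2 m V W (xc m i) (ye m j) w / ((hy m j + hy m (j + 1)) / 2))"

lemma flux_x_eq:
  "flux_x m V W w r i j =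
     conductance_x m V W w i j *
     (r (i + 1) j / equilibrium m V W w (i + 1) j - r i j / equilibrium m V W w i j)"
  by (simp add: flux_x_def conductance_x_def equilibrium_def)

lemma flux_y_eq:
  "flux_y m V W w r i j =
     conductance_y m V W w i j *
     (r i (j + 1) / equilibrium m V W w i (j + 1) - r i j / equilibrium m V W w i j)"
  by (simp add: flux_y_def conductance_y_def equilibrium_def)

lemma conductance_x_nonneg:
  assumes "cartesian_mesh a b c d m" "i \<le> Nx m"
  shows "0 \<le> conductance_x m V W w i j"
proof (cases "i = 0 \<or> i = Nx m")
  case False
  then have "0 < hx m i" "0 < hx m (i + 1)"
    using assms by (auto intro!: cartesian_mesh_hx_pos)
  then show ?thesis
    using less_imp_le[OF Q2_pos] by (simp add: conductance_x_def)
qed (simp add: conductance_x_def)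

lemma conductance_y_nonneg:
  assumes "cartesian_mesh a b c d m" "j \<le> Ny m"
  shows "0 \<le> conductance_y m V W w i j"
proof (cases "j = 0 \<or> j = Ny m")
  case False
  then have "0 < hy m j" "0 < hy m (j + 1)"
    using assms by (auto intro!: cartesian_mesh_hy_pos)
  then show ?thesis
    using less_imp_le[OF Q2_pos] by (simp add: conductance_y_def)
qed (simp add: conductance_y_def)

section \<open>Conservation of mass\<close>

definition mass :: "mesh \<Rightarrow> grid \<Rightarrow> real" where
  "mass m r = (\<Sum>i=1..Nx m. \<Sum>j=1..Ny m. hx m i * hy m j * r i j)"

text \<open>The boundary terms that remain after telescoping are the vanishing boundary fluxes.\<close>

lemma implicit_step_mass:
  assumes mesh: "cartesian_mesh a b c d m" and "s \<noteq> 0"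
    and step: "implicit_step m V W s w r r'"
  shows "mass m r' = mass m r"
proof -
  let ?F = "flux_x m V W w r'" and ?G = "flux_y m V W w r'"
  have tele: "(\<Sum>k=1..n. f k - f (k - 1)) = f n - f 0" for f :: "nat \<Rightarrow> real" and n
    by (induction n) auto
  have area_step: "hx m i * hy m j * (r' i j - r i j) =
      s * (hy m j * (?F i j - ?F (i - 1) j) + hx m i * (?G i j - ?G i (j - 1)))"
    if "i \<in> {1..Nx m}" "j \<in> {1..Ny m}" for i j
  proof -
    have "hx m i \<noteq> 0" "hy m j \<noteq> 0"
      using that cartesian_mesh_hx_pos[OF mesh] cartesian_mesh_hy_pos[OF mesh]
      by (metis less_irrefl)+
    moreover have "r' i j - r i j =
        s * ((?F i j - ?F (i - 1) j) / hx m i + (?G i j - ?G i (j - 1)) / hy m j)"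
      using step that \<open>s \<noteq> 0\<close> unfolding implicit_step_def
      by (metis mult.commute nonzero_eq_divide_eq)
    ultimately show ?thesis
      by (simp add: field_simps)
  qed
  have x_part: "(\<Sum>i=1..Nx m. \<Sum>j=1..Ny m. hy m j * (?F i j - ?F (i - 1) j)) = 0"
  proof -
    have "(\<Sum>i=1..Nx m. \<Sum>j=1..Ny m. hy m j * (?F i j - ?F (i - 1) j)) =
        (\<Sum>j=1..Ny m. hy m j * (\<Sum>i=1..Nx m. ?F i j - ?F (i - 1) j))"
      by (subst sum.swap) (simp only: sum_distrib_left)
    also have "\<dots> = 0"
      unfolding tele[of "\<lambda>i. ?F i j" "Nx m" for j] by (simp add: flux_x_def)
    finally show ?thesis .
  qed
  have y_part: "(\<Sum>i=1..Nx m. \<Sum>j=1..Ny m. hx m i * (?G i j - ?G i (j - 1))) = 0"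
  proof -
    have "(\<Sum>i=1..Nx m. \<Sum>j=1..Ny m. hx m i * (?G i j - ?G i (j - 1))) =
        (\<Sum>i=1..Nx m. hx m i * (\<Sum>j=1..Ny m. ?G i j - ?G i (j - 1)))"
      by (simp only: sum_distrib_left)
    also have "\<dots> = 0"
      unfolding tele[of "?G i" "Ny m" for i] by (simp add: flux_y_def)
    finally show ?thesis .
  qed
  have "mass m r' - mass m r = (\<Sum>i=1..Nx m. \<Sum>j=1..Ny m. hx m i * hy m j * (r' i j - r i j))"
    by (simp add: mass_def right_diff_distrib sum_subtractf)
  also have "\<dots> = (\<Sum>i=1..Nx m. \<Sum>j=1..Ny m.
      s * (hy m j * (?F i j - ?F (i - 1) j) + hx m i * (?G i j - ?G i (j - 1))))"
    by (intro sum.cong refl area_step)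
  also have "\<dots> = s * ((\<Sum>i=1..Nx m. \<Sum>j=1..Ny m. hy m j * (?F i j - ?F (i - 1) j)) +
      (\<Sum>i=1..Nx m. \<Sum>j=1..Ny m. hx m i * (?G i j - ?G i (j - 1))))"
    by (simp only: sum.distrib sum_distrib_left distrib_left)
  finally show ?thesis
    unfolding x_part y_part by simp
qed

lemma two_step_mass:
  assumes mesh: "cartesian_mesh a b c d m" and "0 < \<tau>"
    and step: "two_step m V W \<tau> r\<^sub>0 r\<^sub>1 r\<^sub>2"
  shows "mass m r\<^sub>2 = mass m r\<^sub>1"
proof -
  obtain rs where rs: "implicit_step m V W (\<tau> / 2) (\<lambda>i j. 3 / 2 * r\<^sub>1 i j - 1 / 2 * r\<^sub>0 i j) r\<^sub>1 rs"
    and r2: "\<forall>i\<in>{1..Nx m}. \<forall>j\<in>{1..Ny m}. r\<^sub>2 i j = 2 * rs i j - r\<^sub>1 i j"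
    using step unfolding two_step_def by blast
  have "mass m r\<^sub>2 = (\<Sum>i=1..Nx m. \<Sum>j=1..Ny m.
      2 * (hx m i * hy m j * rs i j) - hx m i * hy m j * r\<^sub>1 i j)"
    unfolding mass_def using r2 by (intro sum.cong refl) (simp add: right_diff_distrib mult_ac)
  also have "\<dots> = 2 * mass m rs - mass m r\<^sub>1"
    by (simp add: mass_def sum_subtractf sum_distrib_left)
  also have "mass m rs = mass m r\<^sub>1"
    using implicit_step_mass[OF mesh _ rs] \<open>0 < \<tau>\<close> by simp
  finally show ?thesis by simp
qed

lemma mono_upto:
  fixes e :: "nat \<Rightarrow> 'a::preorder"
  assumes "\<And>i. i \<in> {1..n} \<Longrightarrow> e (i - 1) \<le> e i" and "k \<le> l" "l \<le> n"
  shows "e k \<le> e l"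
  using assms(2,3)
proof (induction l rule: dec_induct)
  case (step l)
  then have "e k \<le> e l" by simp
  also have "e l \<le> e (Suc l)" using assms(1)[of "Suc l"] step.prems by simp
  finally show ?case .
qed simp

lemma slab_in_sets_lebesgue:
  fixes k :: "'a::euclidean_space"
  shows "{p. s \<le> p \<bullet> k \<and> p \<bullet> k \<le> t} \<in> sets lebesgue"
proof -
  have "closed {p. s \<le> p \<bullet> k \<and> p \<bullet> k \<le> t}"
    by (intro closed_Collect_conj closed_Collect_le continuous_intros)
  then show ?thesis
    by (intro sets_completionI_sets) (simp add: borel_closed)
qed

text \<open>
  Adjacent slabs share a piece of a hyperplane, which is a null set. Stating this for an arbitrary
  coordinate direction makes one lemma serve both directions of the mesh.
\<close>

lemma set_integral_split_slabs:
  fixes f :: "'a::euclidean_space \<Rightarrow> real" and e :: "nat \<Rightarrow> real"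
  assumes S: "S \<in> sets lebesgue" and f: "set_integrable lebesgue S f"
    and k: "k \<in> Basis" and e: "\<And>i. i \<in> {1..n} \<Longrightarrow> e (i - 1) \<le> e i"
  shows "(LINT p:S \<inter> {p. e 0 \<le> p \<bullet> k \<and> p \<bullet> k \<le> e n}|lebesgue. f p) =
    (\<Sum>i=1..n. LINT p:S \<inter> {p. e (i - 1) \<le> p \<bullet> k \<and> p \<bullet> k \<le> e i}|lebesgue. f p)"
proof -
  let ?H = "\<lambda>s t. S \<inter> {p. s \<le> p \<bullet> k \<and> p \<bullet> k \<le> t}"
  have meas: "?H s t \<in> sets lebesgue" for s t
    using S slab_in_sets_lebesgue by (rule sets.Int)
  have int: "set_integrable lebesgue (?H s t) f" for s t
    by (rule set_integrable_subset[OF f meas]) blast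
  have null: "AE p in lebesgue. p \<bullet> k \<noteq> s" for s
  proof -
    have "{p. p \<bullet> k = s} \<in> null_sets lebesgue"
      using negligible_standard_hyperplane[OF k] by (simp add: negligible_iff_null_sets)
    then show ?thesis by (rule AE_I') auto
  qed
  show ?thesis
    using e
  proof (induction n)
    case 0
    have "AE p in lebesgue. indicator (?H (e 0) (e 0)) p *\<^sub>R f p = 0"
      using null[of "e 0"] by eventually_elim (auto simp: indicator_def)
    then show ?case
      by (simp add: set_lebesgue_integral_def integral_eq_zero_AE)
  next
    case (Suc n)
    have le: "e 0 \<le> e n"
      by (rule mono_upto[where n = "Suc n"]) (use Suc.prems in auto)
    have "e n \<le> e (Suc n)" using Suc.prems[of "Suc n"] by simp
    then have "?H (e 0) (e (Suc n)) = ?H (e 0) (e n) \<union> ?H (e n) (e (Suc n))"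
      using le by auto
    moreover have "AE p in lebesgue. \<not> (p \<in> ?H (e 0) (e n) \<and> p \<in> ?H (e n) (e (Suc n)))"
      using null[of "e n"] by eventually_elim auto
    ultimately have "(LINT p:?H (e 0) (e (Suc n))|lebesgue. f p) =
        (LINT p:?H (e 0) (e n)|lebesgue. f p) + (LINT p:?H (e n) (e (Suc n))|lebesgue. f p)"
      using set_integral_Un_AE[OF _ meas meas int int] by simp
    then show ?case using Suc by simp
  qed
qed

lemma cell_averages_mass:
  assumes mesh: "cartesian_mesh a b c d m"
    and f: "set_integrable lebesgue ({a..b} \<times> {c..d}) f"
    and r: "cell_averages m f r"
  shows "mass m r = (LINT p:{a..b} \<times> {c..d}|lebesgue. f p)"
proof -
  let ?R = "{a..b} \<times> {c..d}"
  let ?C = "\<lambda>i. ?R \<inter> {p. xe m (i - 1) \<le> p \<bullet> (1, 0) \<and> p \<bullet> (1, 0) \<le> xe m i}"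
  let ?D = "\<lambda>i j. ?C i \<inter> {p. ye m (j - 1) \<le> p \<bullet> (0, 1) \<and> p \<bullet> (0, 1) \<le> ye m j}"
  have x: "xe m (i - 1) \<le> xe m i" if "i \<in> {1..Nx m}" for i
    using mesh that by (simp add: cartesian_mesh_def less_imp_le)
  have y: "ye m (j - 1) \<le> ye m j" if "j \<in> {1..Ny m}" for j
    using mesh that by (simp add: cartesian_mesh_def less_imp_le)
  have ends: "xe m 0 = a" "xe m (Nx m) = b" "ye m 0 = c" "ye m (Ny m) = d"
    using mesh by (simp_all add: cartesian_mesh_def)
  have R: "?R \<in> sets lebesgue"
    by (intro sets_completionI_sets) (simp add: borel_closed closed_Times)
  have C: "?C i \<in> sets lebesgue" for i
    using R slab_in_sets_lebesgue by (rule sets.Int)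
  have D: "?D i j = cell m i j" if "i \<in> {1..Nx m}" "j \<in> {1..Ny m}" for i j
  proof -
    have "a \<le> xe m (i - 1)" "xe m i \<le> b"
      using that mono_upto[where e = "xe m", OF x, of "Nx m" 0 "i - 1"] mono_upto[where e = "xe m", OF x, of "Nx m" i "Nx m"]
      by (auto simp: ends)
    moreover have "c \<le> ye m (j - 1)" "ye m j \<le> d"
      using that mono_upto[where e = "ye m", OF y, of "Ny m" 0 "j - 1"] mono_upto[where e = "ye m", OF y, of "Ny m" j "Ny m"]
      by (auto simp: ends)
    ultimately show ?thesis by (auto simp: cell_def)
  qed
  have "mass m r = (\<Sum>i=1..Nx m. \<Sum>j=1..Ny m. LINT p:cell m i j|lebesgue. f p)"
    unfolding mass_def
  proof (intro sum.cong refl)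
    fix i j assume ij: "i \<in> {1..Nx m}" "j \<in> {1..Ny m}"
    have "hx m i * hy m j \<noteq> 0"
      using ij cartesian_mesh_hx_pos[OF mesh ij(1)] cartesian_mesh_hy_pos[OF mesh ij(2)] by simp
    moreover have "r i j = 1 / (hx m i * hy m j) * (LINT p:cell m i j|lebesgue. f p)"
      using r ij by (simp add: cell_averages_def)
    ultimately show "hx m i * hy m j * r i j = (LINT p:cell m i j|lebesgue. f p)"
      by simp
  qed
  also have "\<dots> = (\<Sum>i=1..Nx m. \<Sum>j=1..Ny m. LINT p:?D i j|lebesgue. f p)"
    using D by (intro sum.cong refl) simp
  also have "\<dots> = (\<Sum>i=1..Nx m. LINT p:?C i|lebesgue. f p)"
  proof (intro sum.cong refl)
    fix i
    have "(0, 1) \<in> (Basis :: (real \<times> real) set)" by (simp add: Basis_prod_def)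
    moreover have "set_integrable lebesgue (?C i) f"
      by (rule set_integrable_subset[OF f C]) blast
    ultimately have "(LINT p:?C i \<inter> {p. ye m 0 \<le> p \<bullet> (0, 1) \<and> p \<bullet> (0, 1) \<le> ye m (Ny m)}|lebesgue. f p) =
        (\<Sum>j=1..Ny m. LINT p:?D i j|lebesgue. f p)"
      using y by (intro set_integral_split_slabs C)
    moreover have "?C i \<inter> {p. ye m 0 \<le> p \<bullet> (0, 1) \<and> p \<bullet> (0, 1) \<le> ye m (Ny m)} = ?C i"
      by (auto simp: ends)
    ultimately show "(\<Sum>j=1..Ny m. LINT p:?D i j|lebesgue. f p) = (LINT p:?C i|lebesgue. f p)"
      by simp
  qed
  also have "\<dots> = (LINT p:?R|lebesgue. f p)"
  proof -
    have "(1, 0) \<in> (Basis :: (real \<times> real) set)" by (simp add: Basis_prod_def)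
    then have "(LINT p:?R \<inter> {p. xe m 0 \<le> p \<bullet> (1, 0) \<and> p \<bullet> (1, 0) \<le> xe m (Nx m)}|lebesgue. f p) =
        (\<Sum>i=1..Nx m. LINT p:?C i|lebesgue. f p)"
      using x by (intro set_integral_split_slabs R f)
    moreover have "?R \<inter> {p. xe m 0 \<le> p \<bullet> (1, 0) \<and> p \<bullet> (1, 0) \<le> xe m (Nx m)} = ?R"
      by (auto simp: ends)
    ultimately show ?thesis by simp
  qed
  finally show ?thesis .
qed

section \<open>Positivity\<close>

text \<open>
  Discrete minimum principle for the quotient of the new density by the equilibrium. The density
  itself need not increase where it is minimal, because the equilibrium varies from cell to cell.
\<close>

lemma implicit_step_nonneg:
  assumes mesh: "cartesian_mesh a b c d m" and "0 < s"
    and r: "grid_nonneg m r" and step: "implicit_step m V W s w r r'"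
  shows "grid_nonneg m r'"
proof -
  let ?M = "equilibrium m V W w"
  let ?F = "flux_x m V W w r'" and ?G = "flux_y m V W w r'"
  let ?A = "conductance_x m V W w" and ?B = "conductance_y m V W w"
  let ?I = "{1..Nx m} \<times> {1..Ny m}"
  define g where "g i j = r' i j / ?M i j" for i j
  have "?I \<noteq> {}" using mesh by (simp add: cartesian_mesh_def)
  then obtain p where p: "p \<in> ?I" and p_min: "\<And>q. q \<in> ?I \<Longrightarrow> g (fst p) (snd p) \<le> g (fst q) (snd q)"
    using ex_is_arg_min_if_finite[of ?I "\<lambda>q. g (fst q) (snd q)"]
    by (auto simp: is_arg_min_linorder)
  define i j where "i = fst p" and "j = snd p"
  have ij: "i \<in> {1..Nx m}" "j \<in> {1..Ny m}" using p by (auto simp: i_def j_def)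
  have min: "g i j \<le> g k l" if "k \<in> {1..Nx m}" "l \<in> {1..Ny m}" for k l
    using p_min[of "(k, l)"] that by (simp add: i_def j_def)
  have Fr: "0 \<le> ?F i j"
  proof (cases "i = Nx m")
    case False
    then have "0 \<le> g (i + 1) j - g i j" using min[of "i + 1" j] ij by simp
    then have "0 \<le> ?A i j * (g (i + 1) j - g i j)"
      using conductance_x_nonneg[OF mesh, of i] ij by (intro mult_nonneg_nonneg) auto
    then show ?thesis by (simp add: flux_x_eq g_def)
  qed (simp add: flux_x_def)
  have Fl: "?F (i - 1) j \<le> 0"
  proof (cases "i = 1")
    case False
    then have "i - 1 \<in> {1..Nx m}" using ij by auto
    then have "g i j - g (i - 1) j \<le> 0" using min ij by simp
    then have "?A (i - 1) j * (g i j - g (i - 1) j) \<le> 0"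
      using conductance_x_nonneg[OF mesh, of "i - 1"] ij by (intro mult_nonneg_nonpos) auto
    then show ?thesis using ij by (simp add: flux_x_eq g_def)
  qed (simp add: flux_x_def)
  have Gr: "0 \<le> ?G i j"
  proof (cases "j = Ny m")
    case False
    then have "0 \<le> g i (j + 1) - g i j" using min[of i "j + 1"] ij by simp
    then have "0 \<le> ?B i j * (g i (j + 1) - g i j)"
      using conductance_y_nonneg[OF mesh, of j] ij by (intro mult_nonneg_nonneg) auto
    then show ?thesis by (simp add: flux_y_eq g_def)
  qed (simp add: flux_y_def)
  have Gl: "?G i (j - 1) \<le> 0"
  proof (cases "j = 1")
    case False
    then have "j - 1 \<in> {1..Ny m}" using ij by auto
    then have "g i j - g i (j - 1) \<le> 0" using min ij by simp
    then have "?B i (j - 1) * (g i j - g i (j - 1)) \<le> 0"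
      using conductance_y_nonneg[OF mesh, of "j - 1"] ij by (intro mult_nonneg_nonpos) auto
    then show ?thesis using ij by (simp add: flux_y_eq g_def)
  qed (simp add: flux_y_def)
  have "0 \<le> (?F i j - ?F (i - 1) j) / hx m i + (?G i j - ?G i (j - 1)) / hy m j"
    using Fr Fl Gr Gl cartesian_mesh_hx_pos[OF mesh ij(1)] cartesian_mesh_hy_pos[OF mesh ij(2)]
    by (intro add_nonneg_nonneg divide_nonneg_pos) auto
  then have "0 \<le> (r' i j - r i j) / s"
    using step ij by (simp add: implicit_step_def)
  then have "r i j \<le> r' i j"
    using \<open>0 < s\<close> by (simp add: zero_le_divide_iff)
  moreover have "0 \<le> r i j"
    using r ij by (simp add: grid_nonneg_def)
  ultimately have "0 \<le> r' i j"
    by (rule order_trans[rotated])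
  then have "0 \<le> g i j"
    using equilibrium_pos[of m V W w i j] by (simp add: g_def)
  then have "0 \<le> g k l" if "k \<in> {1..Nx m}" "l \<in> {1..Ny m}" for k l
    using min[OF that] by linarith
  then have "0 \<le> g k l * ?M k l" if "k \<in> {1..Nx m}" "l \<in> {1..Ny m}" for k l
    using that by (intro mult_nonneg_nonneg less_imp_le[OF equilibrium_pos])
  moreover have "g k l * ?M k l = r' k l" for k l
    using equilibrium_pos[of m V W w k l] by (simp add: g_def)
  ultimately show ?thesis by (simp add: grid_nonneg_def)
qed

text \<open>Up to sign, this is the diagonal of the linear operator on the right-hand side of the scheme.\<close>

definition outflow_rate ::
  "mesh \<Rightarrow> (real \<Rightarrow> real \<Rightarrow> real) \<Rightarrow> (real \<Rightarrow> real \<Rightarrow> real) \<Rightarrow> grid \<Rightarrow> grid" where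
  "outflow_rate m V W w i j =
     ((conductance_x m V W w i j + conductance_x m V W w (i - 1) j) / hx m i +
      (conductance_y m V W w i j + conductance_y m V W w i (j - 1)) / hy m j)
     / equilibrium m V W w i j"

lemma outflow_rate_nonneg:
  assumes "cartesian_mesh a b c d m" "i \<in> {1..Nx m}" "j \<in> {1..Ny m}"
  shows "0 \<le> outflow_rate m V W w i j"
  unfolding outflow_rate_def
  using assms conductance_x_nonneg[OF assms(1)] conductance_y_nonneg[OF assms(1)]
    cartesian_mesh_hx_pos[OF assms(1,2)] cartesian_mesh_hy_pos[OF assms(1,3)]
  by (intro divide_nonneg_pos add_nonneg_nonneg equilibrium_pos) auto

text \<open>
  Nonnegative neighbouring densities only contribute inflow, so a cell loses mass at most at its
  outflow rate.
\<close>

lemma implicit_step_lower_bound: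
  assumes mesh: "cartesian_mesh a b c d m" and "0 < s"
    and r': "grid_nonneg m r'" and step: "implicit_step m V W s w r r'"
    and ij: "i \<in> {1..Nx m}" "j \<in> {1..Ny m}"
  shows "r i j \<le> (1 + s * outflow_rate m V W w i j) * r' i j"
proof -
  let ?M = "equilibrium m V W w"
  let ?F = "flux_x m V W w r'" and ?G = "flux_y m V W w r'"
  let ?A = "conductance_x m V W w" and ?B = "conductance_y m V W w"
  define g where "g i j = r' i j / ?M i j" for i j
  have g: "0 \<le> g k l" if "k \<in> {1..Nx m}" "l \<in> {1..Ny m}" for k l
    using r' that equilibrium_pos[of m V W w k l] by (simp add: grid_nonneg_def g_def)
  have Fr: "- ?A i j * g i j \<le> ?F i j"
  proof (cases "i = Nx m")
    case False
    then have "0 \<le> ?A i j * g (i + 1) j"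
      using ij by (intro mult_nonneg_nonneg g conductance_x_nonneg[OF mesh]) auto
    then show ?thesis by (simp add: flux_x_eq g_def right_diff_distrib)
  qed (simp add: flux_x_def conductance_x_def)
  have Fl: "?F (i - 1) j \<le> ?A (i - 1) j * g i j"
  proof (cases "i = 1")
    case False
    then have "0 \<le> ?A (i - 1) j * g (i - 1) j"
      using ij by (intro mult_nonneg_nonneg g conductance_x_nonneg[OF mesh]) auto
    then show ?thesis using ij by (simp add: flux_x_eq g_def right_diff_distrib)
  qed (simp add: flux_x_def conductance_x_def)
  have Gr: "- ?B i j * g i j \<le> ?G i j"
  proof (cases "j = Ny m")
    case False
    then have "0 \<le> ?B i j * g i (j + 1)"
      using ij by (intro mult_nonneg_nonneg g conductance_y_nonneg[OF mesh]) auto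
    then show ?thesis by (simp add: flux_y_eq g_def right_diff_distrib)
  qed (simp add: flux_y_def conductance_y_def)
  have Gl: "?G i (j - 1) \<le> ?B i (j - 1) * g i j"
  proof (cases "j = 1")
    case False
    then have "0 \<le> ?B i (j - 1) * g i (j - 1)"
      using ij by (intro mult_nonneg_nonneg g conductance_y_nonneg[OF mesh]) auto
    then show ?thesis using ij by (simp add: flux_y_eq g_def right_diff_distrib)
  qed (simp add: flux_y_def conductance_y_def)
  have "- outflow_rate m V W w i j * r' i j =
      (- (?A i j + ?A (i - 1) j) * g i j) / hx m i + (- (?B i j + ?B i (j - 1)) * g i j) / hy m j"
    by (simp add: outflow_rate_def g_def divide_inverse algebra_simps)
  also have "\<dots> \<le> (?F i j - ?F (i - 1) j) / hx m i + (?G i j - ?G i (j - 1)) / hy m j"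
    using Fr Fl Gr Gl cartesian_mesh_hx_pos[OF mesh ij(1)] cartesian_mesh_hy_pos[OF mesh ij(2)]
    by (intro add_mono divide_right_mono) (auto simp: algebra_simps)
  also have "\<dots> = (r' i j - r i j) / s"
    using step ij by (simp add: implicit_step_def)
  finally show ?thesis
    using \<open>0 < s\<close> by (simp add: field_simps)
qed

lemma two_step_nonneg:
  assumes mesh: "cartesian_mesh a b c d m" and "0 < \<tau>"
    and r1: "grid_nonneg m r\<^sub>1" and step: "two_step m V W \<tau> r\<^sub>0 r\<^sub>1 r\<^sub>2"
    and small: "\<And>i j. i \<in> {1..Nx m} \<Longrightarrow> j \<in> {1..Ny m} \<Longrightarrow>
      \<tau> / 2 * outflow_rate m V W (\<lambda>i j. 3 / 2 * r\<^sub>1 i j - 1 / 2 * r\<^sub>0 i j) i j \<le> 1"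
  shows "grid_nonneg m r\<^sub>2"
proof -
  define w where "w i j = 3 / 2 * r\<^sub>1 i j - 1 / 2 * r\<^sub>0 i j" for i j
  obtain rs where rs: "implicit_step m V W (\<tau> / 2) w r\<^sub>1 rs"
    and r2: "\<forall>i\<in>{1..Nx m}. \<forall>j\<in>{1..Ny m}. r\<^sub>2 i j = 2 * rs i j - r\<^sub>1 i j"
    using step unfolding two_step_def w_def by blast
  have half: "0 < \<tau> / 2" using \<open>0 < \<tau>\<close> by simp
  have nonneg: "grid_nonneg m rs"
    by (rule implicit_step_nonneg[OF mesh half r1 rs])
  have "r\<^sub>1 i j \<le> 2 * rs i j" if ij: "i \<in> {1..Nx m}" "j \<in> {1..Ny m}" for i j
  proof -
    have "r\<^sub>1 i j \<le> (1 + \<tau> / 2 * outflow_rate m V W w i j) * rs i j"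
      by (rule implicit_step_lower_bound[OF mesh half nonneg rs ij])
    also have "\<dots> \<le> 2 * rs i j"
      using small[OF ij, folded w_def] nonneg ij
      by (intro mult_right_mono) (auto simp: grid_nonneg_def)
    finally show ?thesis .
  qed
  then show ?thesis using r2 by (simp add: grid_nonneg_def)
qed

theorem theorem5p3:
  fixes V W :: "real \<Rightarrow> real \<Rightarrow> real" and a b c d :: real and m :: mesh
  assumes W_sym: "\<And>x y. W x y = W (- x) (- y)"
    and mesh: "cartesian_mesh a b c d m"
  shows
    "(\<forall>(\<rho>\<^sub>0 :: real \<times> real \<Rightarrow> real) (\<tau> :: real) (\<rho> :: nat \<Rightarrow> grid).
        set_integrable lebesgue ({a..b} \<times> {c..d}) \<rho>\<^sub>0 \<longrightarrow>
        0 < \<tau> \<longrightarrow>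
        cell_averages m \<rho>\<^sub>0 (\<rho> 0) \<longrightarrow>
        first_order_step m V W \<tau> (\<rho> 0) (\<rho> 1) \<longrightarrow>
        (\<forall>n\<ge>1. two_step m V W \<tau> (\<rho> (n - 1)) (\<rho> n) (\<rho> (n + 1))) \<longrightarrow>
        (\<forall>n\<ge>1. (\<Sum>i=1..Nx m. \<Sum>j=1..Ny m. hx m i * hy m j * \<rho> n i j) =
               (LINT p:{a..b} \<times> {c..d}|lebesgue. \<rho>\<^sub>0 p)))
     \<and>
     (\<forall>r\<^sub>0 r\<^sub>1. grid_nonneg m r\<^sub>1 \<longrightarrow>
        (\<exists>\<tau>\<^sub>0>0. \<forall>\<tau>\<in>{0<..<\<tau>\<^sub>0}. \<forall>r\<^sub>2.
           two_step m V W \<tau> r\<^sub>0 r\<^sub>1 r\<^sub>2 \<longrightarrow> grid_nonneg m r\<^sub>2))"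
proof (intro conjI allI impI)
  fix \<rho>\<^sub>0 :: "real \<times> real \<Rightarrow> real" and \<tau> :: real and \<rho> :: "nat \<Rightarrow> grid" and n :: nat
  assume int: "set_integrable lebesgue ({a..b} \<times> {c..d}) \<rho>\<^sub>0" and "0 < \<tau>"
    and init: "cell_averages m \<rho>\<^sub>0 (\<rho> 0)" "first_order_step m V W \<tau> (\<rho> 0) (\<rho> 1)"
    and steps: "\<forall>n\<ge>1. two_step m V W \<tau> (\<rho> (n - 1)) (\<rho> n) (\<rho> (n + 1))"
    and "1 \<le> n"
  from \<open>1 \<le> n\<close> have "mass m (\<rho> n) = mass m (\<rho> 0)"
  proof (induction n rule: dec_induct)
    case base
    show ?case
      using init(2) implicit_step_mass[OF mesh] \<open>0 < \<tau>\<close> unfolding first_order_step_def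
      by (metis less_irrefl)
  next
    case (step n)
    then show ?case
      using two_step_mass[OF mesh \<open>0 < \<tau>\<close>] steps by (metis Suc_eq_plus1)
  qed
  also have "\<dots> = (LINT p:{a..b} \<times> {c..d}|lebesgue. \<rho>\<^sub>0 p)"
    by (rule cell_averages_mass[OF mesh int init(1)])
  finally show "(\<Sum>i=1..Nx m. \<Sum>j=1..Ny m. hx m i * hy m j * \<rho> n i j) =
      (LINT p:{a..b} \<times> {c..d}|lebesgue. \<rho>\<^sub>0 p)"
    by (simp add: mass_def)
next
  fix r\<^sub>0 r\<^sub>1 assume r1: "grid_nonneg m r\<^sub>1"
  define w where "w i j = 3 / 2 * r\<^sub>1 i j - 1 / 2 * r\<^sub>0 i j" for i j
  define K where "K = (\<Sum>i=1..Nx m. \<Sum>j=1..Ny m. outflow_rate m V W w i j)"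
  have rate_le: "outflow_rate m V W w i j \<le> K" if "i \<in> {1..Nx m}" "j \<in> {1..Ny m}" for i j
  proof -
    have "outflow_rate m V W w i j \<le> (\<Sum>j=1..Ny m. outflow_rate m V W w i j)"
      using that outflow_rate_nonneg[OF mesh] by (intro member_le_sum) auto
    also have "\<dots> \<le> K"
      unfolding K_def using that outflow_rate_nonneg[OF mesh]
      by (intro member_le_sum[where f = "\<lambda>i. \<Sum>j=1..Ny m. outflow_rate m V W w i j"] sum_nonneg) auto
    finally show ?thesis .
  qed
  have "0 \<le> K" unfolding K_def using outflow_rate_nonneg[OF mesh] by (intro sum_nonneg) auto
  \<comment> \<open>The numerator 2 undoes the half step; adding 1 covers \<open>K = 0\<close>, as on a mesh with one cell.\<close>
  show "\<exists>\<tau>\<^sub>0>0. \<forall>\<tau>\<in>{0<..<\<tau>\<^sub>0}. \<forall>r\<^sub>2. two_step m V W \<tau> r\<^sub>0 r\<^sub>1 r\<^sub>2 \<longrightarrow> grid_nonneg m r\<^sub>2"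
  proof (intro exI[of _ "2 / (K + 1)"] conjI ballI allI impI)
    fix \<tau> r\<^sub>2 assume \<tau>: "\<tau> \<in> {0<..<2 / (K + 1)}" and step: "two_step m V W \<tau> r\<^sub>0 r\<^sub>1 r\<^sub>2"
    show "grid_nonneg m r\<^sub>2"
    proof (rule two_step_nonneg[OF mesh _ r1 step, folded w_def])
      fix i j assume "i \<in> {1..Nx m}" "j \<in> {1..Ny m}"
      then have "\<tau> / 2 * outflow_rate m V W w i j \<le> \<tau> / 2 * (K + 1)"
        using rate_le[of i j] \<tau> by (intro mult_left_mono) auto
      also have "\<dots> \<le> 1"
        using \<tau> \<open>0 \<le> K\<close> by (simp add: field_simps)
      finally show "\<tau> / 2 * outflow_rate m V W w i j \<le> 1" .
    qed (use \<tau> in simp)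
  qed (use \<open>0 \<le> K\<close> in simp)
qed

end
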